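(* Let $X$ be a locale and let $R$ be a closed localic relation on $X$ with open cones. Then $R\cong R_{\Uparrow_R,\Downarrow_R}$ as sublocales of $X\times X$.
   Context: Frames and locales. A frame is a complete lattice (order $\sqsubseteq$) in which $x\wedge\bigvee y_i=\bigvee (x\wedge y_i)$; frame maps preserve finite meets and all joins. The category of locales is the opposite of the category of frames: a locale $X$ has a frame of opens $\mathcal{O}X$, and a map $f\colon X\to Y$ is a frame map $f^{-1}\colon\mathcal{O}Y\to\mathcal{O}X$. $L\otimes M$ is the coproduct of frames, generated under joins by the rectangles $x\otimes y=\iota_1(x)\wedge\iota_2(y)$ ($\iota_1,\iota_2$ the coproduct injections); $\mathcal{O}(X\times Y)=\mathcal{O}X\otimes\mathcal{O}Y$. A sublocale of $X$ is (an isomorphism class of) an extremal monomorphism $A\rightarrowtail X$, equivalently a map whose frame map is surjective. Open cone relations. A localic relation on $X$ is a sublocale $r\colon R\rightarrowtail X\times X$; its source and target maps are $s=\mathrm{pr}_1\circ r$, $t=\mathrm{pr}_2\circ r\colon R\to X$. It is closed if it is a closed sublocale: there is $u\in\mathcal{O}X\otimes\mathcal{O}X$ such that $R$ is represented by the frame $\{o: u\sqsubseteq o\}$ with $r^{-1}(o)=o\vee u$. A locale map $f\colon X\to Y$ is open if $f^{-1}$ has a left adjoint $f_!$ with $f_!(U\wedge f^{-1}(V))=f_!(U)\wedge V$. $R$ has open cones if $s,t$ are open; then its induced cones are $\Uparrow_R:=t_!s^{-1}$ and $\Downarrow_R:=s_!t^{-1}\colon\mathcal{O}X\to\mathcal{O}X$.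 These preserve all joins and are parallel in the sense below. Parallel pairs and induced relation. Functions $\mathsf{u},\mathsf{d}\colon L\to L$ on a frame are parallel if $\mathsf{u}(x)\wedge y\sqsubseteq\mathsf{u}(x\wedge\mathsf{d}(y))$ and $x\wedge\mathsf{d}(y)\sqsubseteq\mathsf{d}(\mathsf{u}(x)\wedge y)$ for all $x,y\in L$. Given such a join-preserving pair on $\mathcal{O}X$, let $\sim$ be the binary relation on rectangles of $\mathcal{O}X\otimes\mathcal{O}X$ with $a\otimes b\sim c\otimes d$ iff $\mathsf{u}(a)\wedge b=\mathsf{u}(c)\wedge d$ and $a\wedge\mathsf{d}(b)=c\wedge\mathsf{d}(d)$. An element $o\in\mathcal{O}X\otimes\mathcal{O}X$ is $\sim$-saturated if for all $p\sim q$ and all $w$: $p\wedge w\sqsubseteq o$ iff $q\wedge w\sqsubseteq o$. $R_{\mathsf{u},\mathsf{d}}\rightarrowtail X\times X$ is the sublocale whose frame is the set of $\sim$-saturated elements, with frame map $\mu_\sim(o)=$ the least $\sim$-saturated element above $o$; equivalently, the quotient of $\mathcal{O}X\otimes\mathcal{O}X$ by the frame congruence generated by $\sim$. *)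

theory Defs
  imports Main
begin

section \<open>Frames and frame maps\<close>

text \<open>The class \<open>complete_distrib_lattice\<close> of the library asks for complete
  distributivity, which is stronger than the frame law.\<close>

class frame = complete_lattice +
  assumes inf_Sup_frame: "inf x (Sup S) = Sup (inf x ` S)"

definition frame_map :: "('a::frame \<Rightarrow> 'b::frame) \<Rightarrow> bool" where
  "frame_map f \<longleftrightarrow> f top = top \<and> (\<forall>x y. f (inf x y) = inf (f x) (f y))
     \<and> (\<forall>S. f (Sup S) = Sup (f ` S))"


section \<open>The coproduct of frames\<close>

text \<open>The coproduct is constructed as the frame of C-ideals: the sets of pairs that are
  downward closed and closed under arbitrary (possibly empty) joins in each coordinate.
  The coproduct property is \<open>coproduct_ex1\<close> below.\<close>

definition cideal :: "('a::frame \<times> 'b::frame) set \<Rightarrow> bool" where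
  "cideal D \<longleftrightarrow>
     (\<forall>a b a' b'. (a, b) \<in> D \<longrightarrow> a' \<le> a \<longrightarrow> b' \<le> b \<longrightarrow> (a', b') \<in> D) \<and>
     (\<forall>S b. (\<forall>a\<in>S. (a, b) \<in> D) \<longrightarrow> (Sup S, b) \<in> D) \<and>
     (\<forall>a S. (\<forall>b\<in>S. (a, b) \<in> D) \<longrightarrow> (a, Sup S) \<in> D)"

lemma cidealD:
  assumes "cideal D"
  shows "(a, b) \<in> D \<Longrightarrow> a' \<le> a \<Longrightarrow> b' \<le> b \<Longrightarrow> (a', b') \<in> D"
    and "(\<forall>a\<in>S. (a, b) \<in> D) \<Longrightarrow> (Sup S, b) \<in> D"
    and "(\<forall>b\<in>S'. (a, b) \<in> D) \<Longrightarrow> (a, Sup S') \<in> D"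
  using assms unfolding cideal_def by simp_all

lemma cideal_UNIV: "cideal UNIV"
  by (simp add: cideal_def)

lemma cideal_Inter: "(\<And>D. D \<in> \<D> \<Longrightarrow> cideal D) \<Longrightarrow> cideal (\<Inter>\<D>)"
  unfolding cideal_def by (intro conjI allI impI InterI; meson InterD)

lemma cideal_Int: "cideal D \<Longrightarrow> cideal E \<Longrightarrow> cideal (D \<inter> E)"
  using cideal_Inter[of "{D, E}"] by auto

typedef (overloaded) ('a, 'b) coprod = "{D :: ('a::frame \<times> 'b::frame) set. cideal D}"
  using cideal_UNIV by blast

setup_lifting type_definition_coprod

instantiation coprod :: (frame, frame) complete_lattice
begin

lift_definition less_eq_coprod :: "('a, 'b) coprod \<Rightarrow> ('a, 'b) coprod \<Rightarrow> bool" is "(\<subseteq>)" .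

lift_definition less_coprod :: "('a, 'b) coprod \<Rightarrow> ('a, 'b) coprod \<Rightarrow> bool" is "(\<subset>)" .

lift_definition Inf_coprod :: "('a, 'b) coprod set \<Rightarrow> ('a, 'b) coprod" is "\<lambda>\<D>. \<Inter>\<D>"
  by (rule cideal_Inter) auto

lift_definition Sup_coprod :: "('a, 'b) coprod set \<Rightarrow> ('a, 'b) coprod"
  is "\<lambda>\<D>. \<Inter>{E. cideal E \<and> (\<forall>D\<in>\<D>. D \<subseteq> E)}"
  by (rule cideal_Inter) auto

lift_definition inf_coprod :: "('a, 'b) coprod \<Rightarrow> ('a, 'b) coprod \<Rightarrow> ('a, 'b) coprod" is "(\<inter>)"
  by (rule cideal_Int)

lift_definition sup_coprod :: "('a, 'b) coprod \<Rightarrow> ('a, 'b) coprod \<Rightarrow> ('a, 'b) coprod"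
  is "\<lambda>D D'. \<Inter>{E. cideal E \<and> D \<subseteq> E \<and> D' \<subseteq> E}"
  by (rule cideal_Inter) auto

lift_definition top_coprod :: "('a, 'b) coprod" is UNIV
  by (rule cideal_UNIV)

lift_definition bot_coprod :: "('a, 'b) coprod" is "\<Inter>{E. cideal E}"
  by (rule cideal_Inter) auto

instance
proof
  fix x y z :: "('a, 'b) coprod" and A :: "('a, 'b) coprod set"
  show "(x < y) = (x \<le> y \<and> \<not> y \<le> x)" by transfer blast
  show "x \<le> x" by transfer blast
  show "x \<le> y \<Longrightarrow> y \<le> z \<Longrightarrow> x \<le> z" by transfer blast
  show "x \<le> y \<Longrightarrow> y \<le> x \<Longrightarrow> x = y" by transfer blast
  show "inf x y \<le> x" "inf x y \<le> y" by (transfer, blast)+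
  show "x \<le> y \<Longrightarrow> x \<le> z \<Longrightarrow> x \<le> inf y z" by transfer blast
  show "x \<le> sup x y" "y \<le> sup x y" by (transfer, blast)+
  show "y \<le> x \<Longrightarrow> z \<le> x \<Longrightarrow> sup y z \<le> x" by transfer blast
  show "x \<in> A \<Longrightarrow> Inf A \<le> x" by transfer blast
  show "(\<And>x. x \<in> A \<Longrightarrow> z \<le> x) \<Longrightarrow> z \<le> Inf A" by transfer blast
  show "x \<in> A \<Longrightarrow> x \<le> Sup A" by transfer blast
  show "(\<And>x. x \<in> A \<Longrightarrow> x \<le> z) \<Longrightarrow> Sup A \<le> z" by transfer blast
  show "Inf {} = (top :: ('a, 'b) coprod)" by transfer blast
  show "Sup {} = (bot :: ('a, 'b) coprod)" by transfer blast
qed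

end

lemma cideal_imp:
  fixes D E :: "('a::frame \<times> 'b::frame) set"
  assumes E: "cideal E"
  shows "cideal {(x, y). \<forall>(a, b)\<in>D. (inf x a, inf y b) \<in> E}"
proof -
  have down: "\<And>a b a' b'. (a, b) \<in> E \<Longrightarrow> a' \<le> a \<Longrightarrow> b' \<le> b \<Longrightarrow> (a', b') \<in> E"
    and j1: "\<And>S b. (\<forall>a\<in>S. (a, b) \<in> E) \<Longrightarrow> (Sup S, b) \<in> E"
    and j2: "\<And>a S. (\<forall>b\<in>S. (a, b) \<in> E) \<Longrightarrow> (a, Sup S) \<in> E"
    using cidealD[OF E] by blast+
  have d1: "inf (Sup S) x = Sup (inf x ` S)" for S and x :: 'a
    by (subst inf_commute) (rule inf_Sup_frame)
  have d2: "inf (Sup S) x = Sup (inf x ` S)" for S and x :: 'b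
    by (subst inf_commute) (rule inf_Sup_frame)
  let ?I = "{(x, y). \<forall>(a, b)\<in>D. (inf x a, inf y b) \<in> E}"
  have I: "(x, y) \<in> ?I \<longleftrightarrow> (\<forall>a b. (a, b) \<in> D \<longrightarrow> (inf x a, inf y b) \<in> E)" for x y
    by blast
  show ?thesis
    unfolding cideal_def I
  proof (intro conjI allI impI)
    fix a b a' b' x y
    assume "\<forall>x y. (x, y) \<in> D \<longrightarrow> (inf a x, inf b y) \<in> E" "a' \<le> a" "b' \<le> b" "(x, y) \<in> D"
    then show "(inf a' x, inf b' y) \<in> E"
      by (meson down inf_mono order_refl)
  next
    fix S b x y
    assume "\<forall>a\<in>S. \<forall>x y. (x, y) \<in> D \<longrightarrow> (inf a x, inf b y) \<in> E" "(x, y) \<in> D"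
    then have "\<forall>a'\<in>inf x ` S. (a', inf b y) \<in> E"
      by (auto simp: inf_commute[of x])
    then show "(inf (Sup S) x, inf b y) \<in> E"
      unfolding d1 by (rule j1)
  next
    fix a S x y
    assume "\<forall>b\<in>S. \<forall>x y. (x, y) \<in> D \<longrightarrow> (inf a x, inf b y) \<in> E" "(x, y) \<in> D"
    then have "\<forall>b'\<in>inf y ` S. (inf a x, b') \<in> E"
      by (auto simp: inf_commute[of y])
    then show "(inf a x, inf (Sup S) y) \<in> E"
      unfolding d2 by (rule j2)
  qed
qed

lift_definition coprod_imp :: "('a::frame, 'b::frame) coprod \<Rightarrow> ('a, 'b) coprod \<Rightarrow> ('a, 'b) coprod"
  is "\<lambda>D E. {(x, y). \<forall>(a, b)\<in>D. (inf x a, inf y b) \<in> E}"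
  by (rule cideal_imp)

lemma coprod_imp_adjoint: "inf D F \<le> E \<longleftrightarrow> F \<le> coprod_imp D E"
proof (transfer, intro iffI subsetI)
  fix D F E :: "('a \<times> 'b) set" and p
  assume c: "cideal D" "cideal F" and le: "D \<inter> F \<subseteq> E" and p: "p \<in> F"
  obtain x y where xy: "p = (x, y)" by force
  have "(inf x a, inf y b) \<in> D \<inter> F" if "(a, b) \<in> D" for a b
    using that p c unfolding xy cideal_def by (meson IntI inf_le1 inf_le2)
  then show "p \<in> {(x, y). \<forall>(a, b)\<in>D. (inf x a, inf y b) \<in> E}"
    using le unfolding xy by blast
next
  fix D F E :: "('a \<times> 'b) set" and p
  assume le: "F \<subseteq> {(x, y). \<forall>(a, b)\<in>D. (inf x a, inf y b) \<in> E}" and p: "p \<in> D \<inter> F"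
  obtain x y where xy: "p = (x, y)" by force
  have "\<forall>(a, b)\<in>D. (inf x a, inf y b) \<in> E" "(x, y) \<in> D"
    using le p unfolding xy by blast+
  then have "(inf x x, inf y y) \<in> E" by blast
  then show "p \<in> E" by (simp add: xy)
qed

instance coprod :: (frame, frame) frame
proof
  fix x :: "('a, 'b) coprod" and S
  have "S' \<le> coprod_imp x (Sup (inf x ` S))" if "S' \<in> S" for S'
    using that by (simp add: coprod_imp_adjoint[symmetric] SUP_upper)
  then have "inf x (Sup S) \<le> Sup (inf x ` S)"
    by (simp add: coprod_imp_adjoint Sup_least)
  moreover have "Sup (inf x ` S) \<le> inf x (Sup S)"
    by (intro SUP_least inf_mono order_refl Sup_upper)
  ultimately show "inf x (Sup S) = Sup (inf x ` S)"
    by (rule order_antisym)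
qed

lemma cideal_inj1: "cideal {(x, y). x \<le> (a::'a::frame) \<or> y = (bot::'b::frame)}"
proof -
  have "Sup S \<le> a \<or> b = (bot::'b)" if "\<forall>x\<in>S. x \<le> a \<or> b = bot" for S b
    using that by (metis Sup_least)
  moreover have "x \<le> a \<or> Sup S = (bot::'b)" if "\<forall>y\<in>S. x \<le> a \<or> y = bot" for S x
    using that by (metis Sup_bot_conv(1))
  ultimately show ?thesis
    unfolding cideal_def by (simp add: bot_unique) (metis order_trans bot_unique)
qed

lemma cideal_inj2: "cideal {(x, y). y \<le> (b::'b::frame) \<or> x = (bot::'a::frame)}"
proof -
  have "Sup S \<le> b \<or> a = (bot::'a)" if "\<forall>y\<in>S. y \<le> b \<or> a = bot" for S a
    using that by (metis Sup_least)
  moreover have "y \<le> b \<or> Sup S = (bot::'a)" if "\<forall>x\<in>S. y \<le> b \<or> x = bot" for S y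
    using that by (metis Sup_bot_conv(1))
  ultimately show ?thesis
    unfolding cideal_def by (simp add: bot_unique) (metis order_trans bot_unique)
qed

lift_definition inj1 :: "'a::frame \<Rightarrow> ('a, 'b::frame) coprod"
  is "\<lambda>a. {(x, y). x \<le> a \<or> y = bot}"
  by (rule cideal_inj1)

lift_definition inj2 :: "'b::frame \<Rightarrow> ('a::frame, 'b) coprod"
  is "\<lambda>b. {(x, y). y \<le> b \<or> x = bot}"
  by (rule cideal_inj2)

definition rect :: "'a::frame \<Rightarrow> 'b::frame \<Rightarrow> ('a, 'b) coprod" (infix "\<otimes>" 75) where
  "a \<otimes> b = inf (inj1 a) (inj2 b)"

lemma cideal_bot:
  assumes "cideal D" shows "(bot, y) \<in> D" "(x, bot) \<in> D"
proof -
  have "(Sup {}, y) \<in> D" "(x, Sup {}) \<in> D"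
    by (simp_all add: cidealD[OF assms] del: Sup_empty)
  then show "(bot, y) \<in> D" "(x, bot) \<in> D" by simp_all
qed

lemma rect_le_iff: "a \<otimes> b \<le> D \<longleftrightarrow> (a, b) \<in> Rep_coprod D"
  unfolding rect_def
proof transfer
  fix a :: 'a and b :: 'b and D :: "('a \<times> 'b) set"
  assume D: "cideal D"
  then have down: "\<And>a' b'. (a, b) \<in> D \<Longrightarrow> a' \<le> a \<Longrightarrow> b' \<le> b \<Longrightarrow> (a', b') \<in> D"
    by (rule cidealD)
  show "{(x, y). x \<le> a \<or> y = bot} \<inter> {(x, y). y \<le> b \<or> x = bot} \<subseteq> D \<longleftrightarrow> (a, b) \<in> D"
    using cideal_bot[OF D] down by auto
qed

lemma coprod_eq_Sup_rect: "D = Sup {a \<otimes> b | a b. a \<otimes> b \<le> D}"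
proof (rule order_antisym)
  have *: "(a, b) \<in> Rep_coprod (Sup {a \<otimes> b | a b. a \<otimes> b \<le> D})" if "(a, b) \<in> Rep_coprod D" for a b
    using that unfolding rect_le_iff[symmetric] by (intro Sup_upper) blast
  then show "D \<le> Sup {a \<otimes> b | a b. a \<otimes> b \<le> D}"
    unfolding less_eq_coprod.rep_eq by auto
qed (auto intro: Sup_least)

lemma frame_map_inj1: "frame_map (inj1 :: 'a::frame \<Rightarrow> ('a, 'b::frame) coprod)"
  unfolding frame_map_def
proof (intro conjI allI)
  fix S :: "'a set"
  show "inj1 (Sup S) = (Sup (inj1 ` S) :: ('a, 'b) coprod)"
  proof (rule order_antisym)
    have r: "inj1 x = (x \<otimes> top :: ('a, 'b) coprod)" for x
      unfolding rect_def by transfer auto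
    have "(x, top) \<in> Rep_coprod (Sup (inj1 ` S) :: ('a, 'b) coprod)" if "x \<in> S" for x
      using that unfolding rect_le_iff[symmetric] r[symmetric] by (rule SUP_upper)
    then have "(Sup S, top) \<in> Rep_coprod (Sup (inj1 ` S) :: ('a, 'b) coprod)"
      using Rep_coprod[of "Sup (inj1 ` S) :: ('a, 'b) coprod"]
      by (simp add: cidealD)
    then show "inj1 (Sup S) \<le> (Sup (inj1 ` S) :: ('a, 'b) coprod)"
      unfolding r rect_le_iff by (simp add: r)
    have "inj1 x \<le> (inj1 (Sup S) :: ('a, 'b) coprod)" if "x \<in> S" for x
      using Sup_upper[OF that] by transfer auto
    then show "(Sup (inj1 ` S) :: ('a, 'b) coprod) \<le> inj1 (Sup S)"
      by (rule SUP_least)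
  qed
qed (transfer; auto)+

lemma frame_map_inj2: "frame_map (inj2 :: 'b::frame \<Rightarrow> ('a::frame, 'b) coprod)"
  unfolding frame_map_def
proof (intro conjI allI)
  fix S :: "'b set"
  show "inj2 (Sup S) = (Sup (inj2 ` S) :: ('a, 'b) coprod)"
  proof (rule order_antisym)
    have r: "inj2 x = (top \<otimes> x :: ('a, 'b) coprod)" for x
      unfolding rect_def by transfer auto
    have "(top, x) \<in> Rep_coprod (Sup (inj2 ` S) :: ('a, 'b) coprod)" if "x \<in> S" for x
      using that unfolding rect_le_iff[symmetric] r[symmetric] by (rule SUP_upper)
    then have "(top, Sup S) \<in> Rep_coprod (Sup (inj2 ` S) :: ('a, 'b) coprod)"
      using Rep_coprod[of "Sup (inj2 ` S) :: ('a, 'b) coprod"]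
      by (simp add: cidealD)
    then show "inj2 (Sup S) \<le> (Sup (inj2 ` S) :: ('a, 'b) coprod)"
      unfolding r rect_le_iff by (simp add: r)
    have "inj2 x \<le> (inj2 (Sup S) :: ('a, 'b) coprod)" if "x \<in> S" for x
      using Sup_upper[OF that] by transfer auto
    then show "(Sup (inj2 ` S) :: ('a, 'b) coprod) \<le> inj2 (Sup S)"
      by (rule SUP_least)
  qed
qed (transfer; auto)+


theorem coproduct_ex1:
  fixes f :: "'a::frame \<Rightarrow> 'c::frame" and g :: "'b::frame \<Rightarrow> 'c"
  assumes f: "frame_map f" and g: "frame_map g"
  shows "\<exists>!h :: ('a, 'b) coprod \<Rightarrow> 'c. frame_map h \<and> h \<circ> inj1 = f \<and> h \<circ> inj2 = g"
proof (rule ex_ex1I)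
  have ft: "f top = top" and fi: "\<And>x y. f (inf x y) = inf (f x) (f y)"
    and fS: "\<And>S. f (Sup S) = Sup (f ` S)"
    using f unfolding frame_map_def by blast+
  have gt: "g top = top" and gi: "\<And>x y. g (inf x y) = inf (g x) (g y)"
    and gS: "\<And>S. g (Sup S) = Sup (g ` S)"
    using g unfolding frame_map_def by blast+
  have fb: "f bot = bot" and gb: "g bot = bot"
    using fS[of "{}"] gS[of "{}"] by simp_all
  have fm: "f x \<le> f y" if "x \<le> y" for x y using fi[of x y] that by (simp add: inf_absorb1 le_iff_inf)
  have gm: "g x \<le> g y" if "x \<le> y" for x y using gi[of x y] that by (simp add: inf_absorb1 le_iff_inf)
  define h :: "('a, 'b) coprod \<Rightarrow> 'c"
    where "h D = (SUP (a, b)\<in>Rep_coprod D. inf (f a) (g b))" for D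
  define k where "k c = {(a, b). inf (f a) (g b) \<le> c}" for c
  have k: "cideal (k c)" for c
    unfolding cideal_def
  proof (intro conjI allI impI)
    fix a b a' b' assume "(a, b) \<in> k c" "a' \<le> a" "b' \<le> b"
    then show "(a', b') \<in> k c"
      unfolding k_def using inf_mono[OF fm gm] order_trans by blast
  next
    fix S b assume "\<forall>a\<in>S. (a, b) \<in> k c"
    then show "(Sup S, b) \<in> k c"
      unfolding k_def by (simp add: fS inf_commute[of _ "g b"] inf_Sup_frame SUP_le_iff)
  next
    fix a S assume "\<forall>b\<in>S. (a, b) \<in> k c"
    then show "(a, Sup S) \<in> k c"
      unfolding k_def by (simp add: gS inf_Sup_frame SUP_le_iff)
  qed
  have adj: "h D \<le> c \<longleftrightarrow> D \<le> Abs_coprod (k c)" for D c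
    unfolding less_eq_coprod.rep_eq using k
    by (auto simp: Abs_coprod_inverse h_def k_def SUP_le_iff)
  have hm: "h D \<le> h E" if "D \<le> E" for D E
    using that adj[of E "h E"] adj[of D "h E"] by simp
  have hS: "h (Sup S) = Sup (h ` S)" for S
  proof (rule order_antisym)
    show "h (Sup S) \<le> Sup (h ` S)"
      unfolding adj by (rule Sup_least) (simp add: adj[symmetric] SUP_upper)
  qed (auto intro: SUP_least hm Sup_upper)
  have h_up: "inf (f a) (g b) \<le> h D" if "(a, b) \<in> Rep_coprod D" for a b D
    unfolding h_def using that by (intro SUP_upper2[of "(a, b)"]) auto
  have hi: "h (inf D E) = inf (h D) (h E)" for D E
  proof (rule order_antisym)
    have "inf (inf (f a) (g b)) (inf (f a') (g b')) \<le> h (inf D E)"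
      if "(a, b) \<in> Rep_coprod D" "(a', b') \<in> Rep_coprod E" for a b a' b'
    proof -
      have "(inf a a', inf b b') \<in> Rep_coprod D" "(inf a a', inf b b') \<in> Rep_coprod E"
        using that Rep_coprod[of D] Rep_coprod[of E] unfolding cideal_def mem_Collect_eq
        by (meson inf_le1 inf_le2)+
      then have "inf (f (inf a a')) (g (inf b b')) \<le> h (inf D E)"
        by (intro h_up) (simp add: inf_coprod.rep_eq)
      then show ?thesis by (simp add: fi gi inf.assoc inf.left_commute)
    qed
    then have *: "inf (inf (f a) (g b)) (h E) \<le> h (inf D E)" if "(a, b) \<in> Rep_coprod D" for a b
      using that unfolding h_def[of E] inf_Sup_frame by (auto intro!: SUP_least)
    have "inf (h E) (h D) \<le> h (inf D E)"
      unfolding h_def[of D] inf_Sup_frame using *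
      by (auto intro!: SUP_least simp: inf_commute)
    then show "inf (h D) (h E) \<le> h (inf D E)" by (simp add: inf_commute)
  qed (auto intro: hm)
  have hr1: "h (inj1 a) = f a" for a
  proof (rule order_antisym)
    show "h (inj1 a) \<le> f a"
      unfolding h_def by (rule SUP_least) (auto simp: inj1.rep_eq gb intro: le_infI1 fm)
    have "inf (f a) (g top) \<le> h (inj1 a)"
      by (rule h_up) (simp add: inj1.rep_eq)
    then show "f a \<le> h (inj1 a)" by (simp add: gt)
  qed
  have hr2: "h (inj2 b) = g b" for b
  proof (rule order_antisym)
    show "h (inj2 b) \<le> g b"
      unfolding h_def by (rule SUP_least) (auto simp: inj2.rep_eq fb intro: le_infI2 gm)
    have "inf (f top) (g b) \<le> h (inj2 b)"
      by (rule h_up) (simp add: inj2.rep_eq)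
    then show "g b \<le> h (inj2 b)" by (simp add: ft)
  qed
  have "h top = top"
    using hm[of "inj1 top" top] by (simp add: hr1 ft top_unique)
  then have "frame_map h" unfolding frame_map_def using hi hS by blast
  then show "\<exists>h :: ('a, 'b) coprod \<Rightarrow> 'c. frame_map h \<and> h \<circ> inj1 = f \<and> h \<circ> inj2 = g"
    using hr1 hr2 by (intro exI[of _ h]) auto
next
  fix h h' :: "('a, 'b) coprod \<Rightarrow> 'c"
  assume h: "frame_map h \<and> h \<circ> inj1 = f \<and> h \<circ> inj2 = g"
    and h': "frame_map h' \<and> h' \<circ> inj1 = f \<and> h' \<circ> inj2 = g"
  have r: "h (a \<otimes> b) = h' (a \<otimes> b)" for a b
    using h h' unfolding frame_map_def rect_def by (metis comp_apply)
  show "h = h'"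
  proof
    fix D
    have "h ` {a \<otimes> b | a b. a \<otimes> b \<le> D} = h' ` {a \<otimes> b | a b. a \<otimes> b \<le> D}"
      by (rule image_cong) (auto simp: r)
    then have "h (Sup {a \<otimes> b | a b. a \<otimes> b \<le> D}) = h' (Sup {a \<otimes> b | a b. a \<otimes> b \<le> D})"
      using h h' by (simp add: frame_map_def)
    then show "h D = h' D" by (simp only: coprod_eq_Sup_rect[of D, symmetric])
  qed
qed


section \<open>Sublocales\<close>

text \<open>A sublocale of the locale with frame of opens \<open>'q\<close> is given by a surjective frame map
  out of \<open>'q\<close>. So that a frame whose elements form a subset of a type can be its codomain,
  a sublocale is a pair \<open>(A, f)\<close>, where the frame \<open>A\<close> carries the order of the ambient type,
  and \<open>f\<close> is the frame map. Isomorphisms of frames are order isomorphisms.\<close>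

type_synonym ('q, 'b) sublocale_rep = "'b set \<times> ('q \<Rightarrow> 'b)"

definition sublocale_iso ::
  "('q::frame, 'b::order) sublocale_rep \<Rightarrow> ('q, 'c::order) sublocale_rep \<Rightarrow> bool" where
  "sublocale_iso = (\<lambda>(A, f) (B, g). \<exists>h. bij_betw h A B
     \<and> (\<forall>x\<in>A. \<forall>y\<in>A. h x \<le> h y \<longleftrightarrow> x \<le> y) \<and> (\<forall>q. h (f q) = g q))"

definition sublocale_of :: "('q::frame \<Rightarrow> 'r::frame) \<Rightarrow> ('q, 'r) sublocale_rep" where
  "sublocale_of f = (UNIV, f)"

definition closed_sublocale :: "'q::frame \<Rightarrow> ('q, 'q) sublocale_rep" where
  "closed_sublocale u = ({q. u \<le> q}, \<lambda>q. sup q u)"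


section \<open>Localic relations with open cones\<close>

definition left_adjoint :: "('b::order \<Rightarrow> 'a::order) \<Rightarrow> ('a \<Rightarrow> 'b) \<Rightarrow> bool" where
  "left_adjoint l f \<longleftrightarrow> (\<forall>U V. l U \<le> V \<longleftrightarrow> U \<le> f V)"

text \<open>A map of locales is represented by its frame map \<open>f\<close>; \<open>open_image f\<close> is the left
  adjoint of \<open>f\<close>, and is meaningful only if this exists.\<close>

definition open_localic_map :: "('a::frame \<Rightarrow> 'b::frame) \<Rightarrow> bool" where
  "open_localic_map f \<longleftrightarrow> frame_map f \<and>
     (\<exists>l. left_adjoint l f \<and> (\<forall>U V. l (inf U (f V)) = inf (l U) V))"

definition open_image :: "('a::frame \<Rightarrow> 'b::frame) \<Rightarrow> 'b \<Rightarrow> 'a" where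
  "open_image f = (THE l. left_adjoint l f)"

lemma open_image_eqI: "left_adjoint l f \<Longrightarrow> open_image f = l"
  unfolding open_image_def left_adjoint_def
  by (rule the_equality) (auto intro!: ext order_antisym)

text \<open>A localic relation on \<open>X\<close> is given by its frame map \<open>r\<close> from the opens of \<open>X \<times> X\<close>
  to the opens of \<open>R\<close>.\<close>

definition localic_relation :: "(('a::frame, 'a) coprod \<Rightarrow> 'r::frame) \<Rightarrow> bool" where
  "localic_relation r \<longleftrightarrow> frame_map r \<and> surj r"

definition closed_relation :: "(('a::frame, 'a) coprod \<Rightarrow> 'r::frame) \<Rightarrow> bool" where
  "closed_relation r \<longleftrightarrow> (\<exists>u. sublocale_iso (sublocale_of r) (closed_sublocale u))"

definition source_map :: "(('a::frame, 'a) coprod \<Rightarrow> 'r::frame) \<Rightarrow> 'a \<Rightarrow> 'r" where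
  "source_map r = r \<circ> inj1"

definition target_map :: "(('a::frame, 'a) coprod \<Rightarrow> 'r::frame) \<Rightarrow> 'a \<Rightarrow> 'r" where
  "target_map r = r \<circ> inj2"

definition open_cones :: "(('a::frame, 'a) coprod \<Rightarrow> 'r::frame) \<Rightarrow> bool" where
  "open_cones r \<longleftrightarrow> open_localic_map (source_map r) \<and> open_localic_map (target_map r)"

definition up_cone :: "(('a::frame, 'a) coprod \<Rightarrow> 'r::frame) \<Rightarrow> 'a \<Rightarrow> 'a" where
  "up_cone r = open_image (target_map r) \<circ> source_map r"

definition down_cone :: "(('a::frame, 'a) coprod \<Rightarrow> 'r::frame) \<Rightarrow> 'a \<Rightarrow> 'a" where
  "down_cone r = open_image (source_map r) \<circ> target_map r"


section \<open>The relation induced by a pair of functions\<close>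

definition rect_rel ::
  "('a::frame \<Rightarrow> 'a) \<Rightarrow> ('a \<Rightarrow> 'a) \<Rightarrow> ('a, 'a) coprod \<Rightarrow> ('a, 'a) coprod \<Rightarrow> bool" where
  "rect_rel u d p q \<longleftrightarrow> (\<exists>a b a' b'. p = a \<otimes> b \<and> q = a' \<otimes> b'
     \<and> inf (u a) b = inf (u a') b' \<and> inf a (d b) = inf a' (d b'))"

definition saturated :: "('q::frame \<Rightarrow> 'q \<Rightarrow> bool) \<Rightarrow> 'q \<Rightarrow> bool" where
  "saturated R x \<longleftrightarrow> (\<forall>p q w. R p q \<longrightarrow> (inf p w \<le> x \<longleftrightarrow> inf q w \<le> x))"

definition saturation :: "('q::frame \<Rightarrow> 'q \<Rightarrow> bool) \<Rightarrow> 'q \<Rightarrow> 'q" where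
  "saturation R x = (LEAST y. saturated R y \<and> x \<le> y)"

definition induced_relation ::
  "('a::frame \<Rightarrow> 'a) \<Rightarrow> ('a \<Rightarrow> 'a) \<Rightarrow> (('a, 'a) coprod, ('a, 'a) coprod) sublocale_rep" where
  "induced_relation u d = ({x. saturated (rect_rel u d) x}, saturation (rect_rel u d))"

end

(* Since r(a (x) b) = s(a) /\ t(b), Frobenius reciprocity for s and t turns a (x) b ~ c (x) d into
   the statement that the two restricted rectangles have the same images under s_! and t_!. Every
   open V of R satisfies V <= s(s_! V) /\ t(t_! V), and s_! r(c (x) d) <= c, t_! r(c (x) d) <= d,
   so related rectangles have the same restriction to R. Hence every element above the u defining R
   is saturated. Conversely, every rectangle below u restricts to bot, so it is related to
   bot (x) bot and lies below every saturated element; hence so does u, the join of such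
   rectangles. Thus R and the induced relation are given by the same closed sublocale. *)

theory Submission
  imports Defs
begin

lemma open_localic_map_adjoint:
  assumes "open_localic_map f"
  shows "open_image f U \<le> V \<longleftrightarrow> U \<le> f V"
    and "open_image f (inf U (f V)) = inf (open_image f U) V"
proof -
  obtain l where l: "left_adjoint l f" and frob: "\<And>U V. l (inf U (f V)) = inf (l U) V"
    using assms unfolding open_localic_map_def by blast
  from l show "open_image f U \<le> V \<longleftrightarrow> U \<le> f V"
    by (simp add: open_image_eqI) (simp add: left_adjoint_def)
  from l frob show "open_image f (inf U (f V)) = inf (open_image f U) V"
    by (simp add: open_image_eqI)
qed

lemma map_rect:
  assumes "frame_map r"
  shows "r (a \<otimes> b) = inf (source_map r a) (target_map r b)"
  using assms by (simp add: frame_map_def rect_def source_map_def target_map_def)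

text \<open>This is Frobenius reciprocity for the target map: \<open>r (a \<otimes> b)\<close> is
  the meet of \<open>source_map r a\<close> and \<open>target_map r b\<close>, and the second factor
  can be pulled out of the image.\<close>

lemma up_cone_rect:
  assumes "frame_map r" "open_cones r"
  shows "inf (up_cone r a) b = open_image (target_map r) (r (a \<otimes> b))"
  using assms by (simp add: open_cones_def up_cone_def map_rect open_localic_map_adjoint(2))

lemma down_cone_rect:
  assumes "frame_map r" "open_cones r"
  shows "inf a (down_cone r b) = open_image (source_map r) (r (a \<otimes> b))"
  using assms
  by (simp add: open_cones_def down_cone_def map_rect open_localic_map_adjoint(2)
      inf_commute[of "source_map r a"] inf_commute[of a])

text \<open>The adjunctions reduce the claim to bounds on the two images of \<open>r p\<close>. One
  inequality suffices, since \<open>rect_rel\<close> is symmetric.\<close>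

lemma rect_rel_cones_le:
  assumes r: "frame_map r" "open_cones r"
    and pq: "rect_rel (up_cone r) (down_cone r) p q"
  shows "r p \<le> r q"
proof -
  let ?s = "source_map r" and ?t = "target_map r"
  obtain a b a' b' where p: "p = a \<otimes> b" and q: "q = a' \<otimes> b'"
    and up: "inf (up_cone r a) b = inf (up_cone r a') b'"
    and down: "inf a (down_cone r b) = inf a' (down_cone r b')"
    using pq unfolding rect_rel_def by blast
  have s: "open_localic_map ?s" and t: "open_localic_map ?t"
    using r(2) by (simp_all add: open_cones_def)
  \<comment> \<open>Written with cones, the images are the left sides of \<open>down\<close> and
    \<open>up\<close>; the right sides are meets with \<open>a'\<close> and
    \<open>b'\<close>.\<close>
  have "open_image ?s (r p) \<le> a'" "open_image ?t (r p) \<le> b'"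
    unfolding p up_cone_rect[OF r, symmetric] down_cone_rect[OF r, symmetric] up down by simp_all
  then have "r p \<le> ?s a'" "r p \<le> ?t b'"
    by (simp_all add: open_localic_map_adjoint(1)[OF s] open_localic_map_adjoint(1)[OF t])
  then show ?thesis
    by (simp add: q map_rect[OF r(1)])
qed

lemma rect_rel_sym: "rect_rel u d p q \<Longrightarrow> rect_rel u d q p"
  unfolding rect_rel_def by metis

text \<open>The isomorphism carries \<open>r q\<close> to \<open>sup q u\<close> and reflects the
  order, so comparisons in the frame of the relation become comparisons modulo
  \<open>u\<close>.\<close>

lemma closed_relationE:
  assumes "closed_relation r"
  obtains u where "sublocale_iso (sublocale_of r) (closed_sublocale u)"
    and "\<And>p q. r p \<le> r q \<longleftrightarrow> p \<le> sup q u"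
proof -
  obtain u where u: "sublocale_iso (sublocale_of r) (closed_sublocale u)"
    using assms unfolding closed_relation_def by blast
  then obtain h where le: "\<And>x y. h x \<le> h y \<longleftrightarrow> x \<le> y" and h: "\<And>q. h (r q) = sup q u"
    unfolding sublocale_iso_def sublocale_of_def closed_sublocale_def by auto
  have "r p \<le> r q \<longleftrightarrow> p \<le> sup q u" for p q
    using le[of "r p" "r q"] by (simp add: h)
  with u show thesis by (rule that)
qed

lemma rect_bot: "bot \<otimes> bot = bot"
  by (rule le_bot)
    (simp only: rect_le_iff cideal_bot(1)[OF Rep_coprod[unfolded mem_Collect_eq]])

lemma saturated_cones_iff:
  assumes r: "frame_map r" "open_cones r"
    and u: "\<And>p q. r p \<le> r q \<longleftrightarrow> p \<le> sup q u"
  shows "saturated (rect_rel (up_cone r) (down_cone r)) x \<longleftrightarrow> u \<le> x"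
proof
  assume x: "saturated (rect_rel (up_cone r) (down_cone r)) x"
  have rbot: "r bot = bot"
    using r(1) unfolding frame_map_def by (metis Sup_empty image_empty)
  have "a \<otimes> b \<le> x" if "a \<otimes> b \<le> u" for a b
  proof -
    have "r (a \<otimes> b) = r (bot \<otimes> bot)"
      using u[of "a \<otimes> b" bot] that by (simp add: rect_bot rbot bot_unique)
    then have "inf (up_cone r a) b = inf (up_cone r bot) bot"
      and "inf a (down_cone r b) = inf bot (down_cone r bot)"
      by (simp_all only: up_cone_rect[OF r] down_cone_rect[OF r])
    then have "rect_rel (up_cone r) (down_cone r) (a \<otimes> b) (bot \<otimes> bot)"
      unfolding rect_rel_def by blast
    \<comment> \<open>Saturation is used at \<open>w = top\<close>, where the right side holds
      trivially.\<close>
    then have "inf (a \<otimes> b) top \<le> x \<longleftrightarrow> inf (bot \<otimes> bot) top \<le> x"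
      using x unfolding saturated_def by blast
    then show ?thesis by (simp add: rect_bot)
  qed
  then show "u \<le> x"
    by (subst coprod_eq_Sup_rect) (auto intro: Sup_least)
next
  assume "u \<le> x"
  \<comment> \<open>Here \<open>sup x u = x\<close>, so lying below \<open>x\<close> can be tested
    after applying \<open>r\<close>, which preserves the meets with \<open>w\<close>.\<close>
  then have le: "p \<le> x \<longleftrightarrow> r p \<le> r x" for p
    by (simp add: u sup_absorb1)
  have "r p = r q" if "rect_rel (up_cone r) (down_cone r) p q" for p q
    using rect_rel_cones_le[OF r that] rect_rel_cones_le[OF r rect_rel_sym[OF that]]
    by (rule order_antisym)
  then show "saturated (rect_rel (up_cone r) (down_cone r)) x"
    using r(1) by (simp add: saturated_def le frame_map_def)
qed

text \<open>The carriers agree by \<open>saturated_cones_iff\<close>, and the least element above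
  both \<open>x\<close> and \<open>u\<close> is \<open>sup x u\<close>; hence an equality of
  representatives, not just an isomorphism.\<close>

lemma induced_relation_cones:
  assumes "frame_map r" "open_cones r" "\<And>p q. r p \<le> r q \<longleftrightarrow> p \<le> sup q u"
  shows "induced_relation (up_cone r) (down_cone r) = closed_sublocale u"
proof -
  have "(LEAST y. u \<le> y \<and> x \<le> y) = sup x u" for x
    by (rule Least_equality) auto
  then show ?thesis
    unfolding induced_relation_def closed_sublocale_def saturation_def saturated_cones_iff[OF assms]
    by simp
qed

theorem proposition9p12:
  fixes r :: "('a::frame, 'a) coprod \<Rightarrow> 'r::frame"
  assumes "localic_relation r"
    and "closed_relation r"
    and "open_cones r"
  shows "sublocale_iso (sublocale_of r) (induced_relation (up_cone r) (down_cone r))"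
proof -
  obtain u where iso: "sublocale_iso (sublocale_of r) (closed_sublocale u)"
    and u: "\<And>p q. r p \<le> r q \<longleftrightarrow> p \<le> sup q u"
    using assms(2) by (elim closed_relationE) (rule that)
  have "frame_map r"
    using assms(1) by (simp add: localic_relation_def)
  with iso show ?thesis
    by (simp only: induced_relation_cones[OF _ assms(3) u])
qed

end
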